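(* Let $C>0$, let $k\ge 1$ be an integer, and let $T$ satisfy $0<T<C/k$; set $r=kT/C$ (so $0<r<1$). Then the online algorithm $\textsc{FlushAll}$ is $\frac{2-r}{1-r}$-competitive in the discrete $k$-wallet model $\mathcal{M}^{C,k}_T$: there is a constant $c$ depending only on the model parameters such that for every transaction sequence $\mathsf{Tx}$ with all values at most $T$, \[ V_{\mathrm{OPT}}(\mathsf{Tx}) \le \frac{2-r}{1-r}\, V_{\textsc{FlushAll}}(\mathsf{Tx}) + c. \]
   Context: Discrete $k$-wallet model $\mathcal{M}^{C,k}_T$: Time is divided into discrete slots $t=1,2,\dots$. A transaction sequence is $\mathsf{Tx}=(\mathsf{tx}_1,\dots,\mathsf{tx}_n)$, where $\mathsf{tx}_t\in[0,T]$ is the value of the transaction arriving at slot $t$ (value $0$ means no transaction). A total collateral $C$ is divided into $k$ wallets, each of capacity $C/k$. Each wallet is either online with some available (uncommitted) collateral $R\in[0,C/k]$, or offline. When a transaction of value $v$ arrives, the policy must immediately either settle it, using an online wallet with $R\ge v$ (whose available collateral becomes $R-v$), or discard it. At any time $t$ the policy may flush a wallet; the wallet is then offline during the slots of the interval $(t,t+F]$ (with $F$ a fixed positive integer flush period), after which it is online again with available collateral reset to $C/k$. For a policy $\mathrm{A}$, $V_{\mathrm{A}}(\mathsf{Tx})$ denotes the total value of transactions it settles. An algorithm is online if its decisions at time $N$ depend only on $\mathsf{tx}_1,\dots,\mathsf{tx}_N$. $\mathrm{OPT}$ denotes an optimal offline $k$-wallet policy, i.e. $V_{\mathrm{OPT}}(\mathsf{Tx})$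 is the maximum settled value achievable by any $k$-wallet policy with full knowledge of $\mathsf{Tx}$. An algorithm $\mathrm{A}$ is $\alpha$-competitive in this model if for every sequence $\mathsf{Tx}$ with values at most $T$, $V_{\mathrm{OPT}}(\mathsf{Tx})\le \alpha V_{\mathrm{A}}(\mathsf{Tx})+O(1)$, where the $O(1)$ constant may depend on $C,k,T$ (and $F$) but not on $\mathsf{Tx}$ or its length. Algorithm $\textsc{FlushAll}$: the wallets are placed in a fixed order $W_1,\dots,W_k$. Each arriving transaction is settled by the first wallet in this order that has enough available collateral to fit it (first fit). When a transaction arrives that fits in no wallet, it is discarded and all $k$ wallets are flushed simultaneously (so all transactions arriving during the following flush period are discarded); afterwards the process repeats. *)

theory Defs
  imports Complex_Main
begin

text \<open>
  The \<open>k\<close> wallets are indexed by \<open>{..<k}\<close>. A wallet is online with some available collateral, or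
  offline for the stated number of slots, the current one included.
\<close>

datatype wallet = Online real | Offline nat

type_synonym state = "nat \<Rightarrow> wallet"

text \<open>
  The decision taken in one slot: the wallet settling the arriving transaction (\<open>None\<close>: it is
  discarded), and the set of wallets flushed. A flush at slot \<open>t\<close> leaves slot \<open>t\<close> itself unaffected,
  since the offline interval is \<open>(t, t + F]\<close>.
\<close>

datatype decision = Decision (target: "nat option") (flushes: "nat set")

definition initial_state :: "real \<Rightarrow> nat \<Rightarrow> state" where
  "initial_state C k = (\<lambda>i. Online (C / real k))"

fun fits :: "wallet \<Rightarrow> real \<Rightarrow> bool" where
  "fits (Online R) v \<longleftrightarrow> v \<le> R"
| "fits (Offline m) v \<longleftrightarrow> False"

definition admissible :: "nat \<Rightarrow> state \<Rightarrow> real \<Rightarrow> decision \<Rightarrow> bool" where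
  "admissible k st v d \<longleftrightarrow>
     flushes d \<subseteq> {..<k} \<and> (\<forall>i. target d = Some i \<longrightarrow> i < k \<and> fits (st i) v)"

definition next_state ::
  "real \<Rightarrow> nat \<Rightarrow> nat \<Rightarrow> state \<Rightarrow> real \<Rightarrow> decision \<Rightarrow> state" where
  "next_state C k F st v d = (\<lambda>i.
     if i \<in> flushes d then Offline F
     else (case st i of
         Online R \<Rightarrow> Online (if target d = Some i then R - v else R)
       | Offline m \<Rightarrow> (if m \<le> 1 then Online (C / real k) else Offline (m - 1))))"

fun feasible_from ::
  "real \<Rightarrow> nat \<Rightarrow> nat \<Rightarrow> state \<Rightarrow> real list \<Rightarrow> decision list \<Rightarrow> bool" where
  "feasible_from C k F st [] [] \<longleftrightarrow> True"
| "feasible_from C k F st (v # vs) (d # ds) \<longleftrightarrow>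
     admissible k st v d \<and> feasible_from C k F (next_state C k F st v d) vs ds"
| "feasible_from C k F st _ _ \<longleftrightarrow> False"

abbreviation feasible :: "real \<Rightarrow> nat \<Rightarrow> nat \<Rightarrow> real list \<Rightarrow> decision list \<Rightarrow> bool" where
  "feasible C k F \<equiv> feasible_from C k F (initial_state C k)"

definition settled_value :: "real list \<Rightarrow> decision list \<Rightarrow> real" where
  "settled_value tx ds = (\<Sum>(v, d) \<leftarrow> zip tx ds. if target d = None then 0 else v)"

definition transaction_seq :: "real \<Rightarrow> real list \<Rightarrow> bool" where
  "transaction_seq T tx \<longleftrightarrow> set tx \<subseteq> {0..T}"

definition V_OPT :: "real \<Rightarrow> nat \<Rightarrow> nat \<Rightarrow> real list \<Rightarrow> real" where
  "V_OPT C k F tx = Max {settled_value tx ds | ds. feasible C k F tx ds}"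

text \<open>
  An online algorithm maps the transactions \<open>tx\<^sub>1, \<dots>, tx\<^sub>N\<close> seen so far to the decision at slot \<open>N\<close>.
\<close>

type_synonym algorithm = "real list \<Rightarrow> decision"

definition decisions :: "algorithm \<Rightarrow> real list \<Rightarrow> decision list" where
  "decisions A tx = map (\<lambda>N. A (take (Suc N) tx)) [0..<length tx]"

definition V_alg :: "algorithm \<Rightarrow> real list \<Rightarrow> real" where
  "V_alg A tx = settled_value tx (decisions A tx)"

definition online_algorithm :: "real \<Rightarrow> nat \<Rightarrow> real \<Rightarrow> nat \<Rightarrow> algorithm \<Rightarrow> bool" where
  "online_algorithm C k T F A \<longleftrightarrow>
     (\<forall>tx. transaction_seq T tx \<longrightarrow> feasible C k F tx (decisions A tx))"

definition competitive :: "real \<Rightarrow> nat \<Rightarrow> real \<Rightarrow> nat \<Rightarrow> real \<Rightarrow> algorithm \<Rightarrow> bool" where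
  "competitive C k T F \<alpha> A \<longleftrightarrow>
     online_algorithm C k T F A \<and>
     (\<exists>c. \<forall>tx. transaction_seq T tx \<longrightarrow> V_OPT C k F tx \<le> \<alpha> * V_alg A tx + c)"

text \<open>
  Under FlushAll the wallets are at any time all online or all offline; the test below that they are
  all online keeps a transaction arriving during a flush period from triggering another flush.
\<close>

definition flush_all_rule :: "nat \<Rightarrow> state \<Rightarrow> real \<Rightarrow> decision" where
  "flush_all_rule k st v =
     (if \<exists>i<k. fits (st i) v then Decision (Some (LEAST i. i < k \<and> fits (st i) v)) {}
      else if \<forall>i<k. \<exists>R. st i = Online R then Decision None {..<k}
      else Decision None {})"

definition flush_all_state :: "real \<Rightarrow> nat \<Rightarrow> nat \<Rightarrow> real list \<Rightarrow> state" where
  "flush_all_state C k F =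
     foldl (\<lambda>st v. next_state C k F st v (flush_all_rule k st v)) (initial_state C k)"

definition flush_all :: "real \<Rightarrow> nat \<Rightarrow> nat \<Rightarrow> algorithm" where
  "flush_all C k F h = flush_all_rule k (flush_all_state C k F (butlast h)) (last h)"


text \<open>The maximum defining \<open>V_OPT\<close> is taken over a finite nonempty set.\<close>

lemma settled_value_Cons:
  "settled_value (v # tx) (d # ds) = (if target d = None then 0 else v) + settled_value tx ds"
  by (simp add: settled_value_def)

lemma finite_settled_values: "finite (range (settled_value tx))"
proof (induction tx)
  case Nil
  then show ?case by (simp add: settled_value_def)
next
  case (Cons v tx)
  have "range (settled_value (v # tx)) \<subseteq>
      insert 0 (range (settled_value tx) \<union> (+) v ` range (settled_value tx))"
  proof
    fix x assume "x \<in> range (settled_value (v # tx))"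
    then obtain ds where ds: "x = settled_value (v # tx) ds" by blast
    show "x \<in> insert 0 (range (settled_value tx) \<union> (+) v ` range (settled_value tx))"
    proof (cases ds)
      case Nil
      then show ?thesis using ds by (simp add: settled_value_def)
    next
      case (Cons d ds')
      then show ?thesis using ds by (auto simp: settled_value_Cons)
    qed
  qed
  then show ?case by (rule finite_subset) (use Cons in simp)
qed

lemma finite_feasible_values: "finite {settled_value tx ds | ds. feasible C k F tx ds}"
  by (rule finite_subset[OF _ finite_settled_values[of tx]]) auto

lemma admissible_flush_all_rule: "admissible k st v (flush_all_rule k st v)"
proof (cases "\<exists>i<k. fits (st i) v")
  case True
  then have "(LEAST i. i < k \<and> fits (st i) v) < k \<and> fits (st (LEAST i. i < k \<and> fits (st i) v)) v"
    by (metis (mono_tags, lifting) LeastI)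
  then show ?thesis using True by (simp add: admissible_def flush_all_rule_def)
next
  case False
  then show ?thesis by (auto simp: admissible_def flush_all_rule_def)
qed

lemma flush_all_feasible_from:
  "feasible_from C k F (flush_all_state C k F pre) post
     (map (\<lambda>N. flush_all C k F (pre @ take (Suc N) post)) [0..<length post])"
proof (induction post arbitrary: pre)
  case Nil
  then show ?case by simp
next
  case (Cons v post)
  let ?d = "flush_all_rule k (flush_all_state C k F pre) v"
  have hd: "flush_all C k F (pre @ [v]) = ?d"
    by (simp add: flush_all_def)
  have st: "flush_all_state C k F (pre @ [v]) =
      next_state C k F (flush_all_state C k F pre) v ?d"
    by (simp add: flush_all_state_def)
  have ds: "map (\<lambda>N. flush_all C k F (pre @ take (Suc N) (v # post))) [0..<length (v # post)] =
      ?d # map (\<lambda>N. flush_all C k F ((pre @ [v]) @ take (Suc N) post)) [0..<length post]"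
    by (simp add: hd map_upt_Suc del: upt_Suc)
  show ?case
    unfolding ds using Cons[of "pre @ [v]"] by (simp add: st admissible_flush_all_rule)
qed

lemma flush_all_feasible: "feasible C k F tx (decisions (flush_all C k F) tx)"
  using flush_all_feasible_from[of C k F "[]" tx]
  by (simp add: decisions_def flush_all_state_def)

lemma online_algorithm_flush_all: "online_algorithm C k T F (flush_all C k F)"
  by (simp add: online_algorithm_def flush_all_feasible)

lemma feasible_values_nonempty: "{settled_value tx ds | ds. feasible C k F tx ds} \<noteq> {}"
  using flush_all_feasible by blast

end

theory Submission
  imports Defs
begin

text \<open>
  Suppose FlushAll starts an epoch with full wallets, settles value \<open>V\<close>, and then at slot \<open>t\<close> a
  transaction fits nowhere. Every wallet then has less than \<open>T\<close> left, so \<open>V \<ge> C - k T = (1 - r) C\<close>.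
  Before slot \<open>t\<close> any other policy settles at most the value \<open>V\<close> that arrived. In the \<open>F + 1\<close> slots
  of \<open>[t, t + F]\<close> it settles at most \<open>C\<close>, because a wallet flushed in that window is back online only
  after it, hence spends at most one charge \<open>C / k\<close> there. So it settles at most
  \<open>V + C \<le> (1 + 1 / (1 - r)) V\<close> per epoch, and the last, possibly incomplete, epoch costs the
  additive constant \<open>C\<close>.
\<close>

section \<open>Value settled by an arbitrary policy in \<open>F + 1\<close> slots\<close>

text \<open>Stands in for reachability from the initial state, so that the arbitrary policy can be
  taken up in the middle of its run.\<close>

definition valid_state :: "real \<Rightarrow> nat \<Rightarrow> state \<Rightarrow> bool" where
  "valid_state C k st \<longleftrightarrow> (\<forall>i<k. \<forall>R. st i = Online R \<longrightarrow> 0 \<le> R \<and> R \<le> C / real k)"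

lemma valid_state_initial: "0 \<le> C \<Longrightarrow> valid_state C k (initial_state C k)"
  by (auto simp: valid_state_def initial_state_def)

lemma valid_state_next:
  assumes "0 \<le> C" and "0 \<le> v" and "valid_state C k st" and "admissible k st v d"
  shows "valid_state C k (next_state C k F st v d)"
  unfolding valid_state_def
proof (intro allI impI)
  fix i R assume i: "i < k" and R: "next_state C k F st v d i = Online R"
  show "0 \<le> R \<and> R \<le> C / real k"
  proof (cases "st i")
    case (Online S)
    then have "0 \<le> S" "S \<le> C / real k" "target d = Some i \<Longrightarrow> v \<le> S"
      using assms(3,4) i by (auto simp: valid_state_def admissible_def)
    then show ?thesis
      using R Online assms(2) by (auto simp: next_state_def split: if_splits)
  next
    case (Offline m)
    then show ?thesis using R assms(1) by (auto simp: next_state_def split: if_splits)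
  qed
qed

text \<open>
  What a wallet can still settle within the next \<open>n \<le> F + 1\<close> slots: no wallet flushed in this window
  returns before its end.
\<close>

fun wallet_bound :: "real \<Rightarrow> nat \<Rightarrow> wallet \<Rightarrow> nat \<Rightarrow> real" where
  "wallet_bound C k (Online R) n = (if n = 0 then 0 else R)"
| "wallet_bound C k (Offline m) n = (if m < n then C / real k else 0)"

lemma wallet_bound_nonneg:
  assumes "0 \<le> C" and "valid_state C k st" and "i < k"
  shows "0 \<le> wallet_bound C k (st i) n"
  using assms by (cases "st i") (auto simp: valid_state_def)

lemma wallet_bound_le:
  assumes "0 \<le> C" and "valid_state C k st" and "i < k"
  shows "wallet_bound C k (st i) n \<le> C / real k"
  using assms by (cases "st i") (auto simp: valid_state_def)

text \<open>The premise \<open>n \<le> F\<close> covers a flush: it leaves \<open>Offline F\<close>,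
  whose bound over \<open>n\<close> further slots is 0. A wallet counting down, or returning as
  \<open>Online (C / real k)\<close>, had this charge in its bound already.\<close>

lemma wallet_bound_step:
  assumes "0 \<le> C" and "0 \<le> v" and "valid_state C k st" and "admissible k st v d"
    and "i < k" and "n \<le> F"
  shows "wallet_bound C k (next_state C k F st v d i) n + (if target d = Some i then v else 0)
    \<le> wallet_bound C k (st i) (Suc n)"
proof (cases "st i")
  case (Online R)
  then have "0 \<le> R" "target d = Some i \<Longrightarrow> v \<le> R"
    using assms by (auto simp: valid_state_def admissible_def)
  then show ?thesis using Online assms(2,6) by (auto simp: next_state_def)
next
  case (Offline m)
  then have "target d \<noteq> Some i" using assms(4) by (auto simp: admissible_def)
  then show ?thesis using Offline assms(1,6) by (auto simp: next_state_def)
qed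

lemma settled_value_le_wallet_bounds:
  assumes "0 \<le> C" and "feasible_from C k F st vs ds" and "valid_state C k st"
    and "set vs \<subseteq> {0..}" and "length vs \<le> Suc F"
  shows "settled_value vs ds \<le> (\<Sum>i<k. wallet_bound C k (st i) (length vs))"
  using assms
proof (induction C k F st vs ds rule: feasible_from.induct)
  case (1 C k F st)
  show ?case
    using 1 by (auto simp: settled_value_def intro!: sum_nonneg wallet_bound_nonneg)
next
  case (2 C k F st v vs d ds)
  have adm: "admissible k st v d" and v: "0 \<le> v" and C: "0 \<le> C"
    using 2 by auto
  let ?st = "next_state C k F st v d"
  have "valid_state C k ?st" using 2 adm v C by (intro valid_state_next) auto
  then have IH: "settled_value vs ds \<le> (\<Sum>i<k. wallet_bound C k (?st i) (length vs))"
    using 2 by auto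
  \<comment> \<open>Attributing the value to the wallet that settles it lets the one-wallet step be
    summed over all wallets.\<close>
  have gain: "(if target d = None then 0 else v) = (\<Sum>i<k. if target d = Some i then v else 0)"
    using adm by (cases "target d") (auto simp: admissible_def)
  have "settled_value (v # vs) (d # ds)
      \<le> (\<Sum>i<k. wallet_bound C k (?st i) (length vs) + (if target d = Some i then v else 0))"
    using IH by (simp add: settled_value_Cons sum.distrib gain)
  also have "\<dots> \<le> (\<Sum>i<k. wallet_bound C k (st i) (length (v # vs)))"
    using 2 C v adm by (auto intro!: sum_mono wallet_bound_step)
  finally show ?case .
qed auto

lemma settled_value_window:
  assumes "0 \<le> C" and "feasible_from C k F st vs ds" and "valid_state C k st"
    and "set vs \<subseteq> {0..}" and "length vs \<le> Suc F"
  shows "settled_value vs ds \<le> C"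
proof -
  have "settled_value vs ds \<le> (\<Sum>i<k. wallet_bound C k (st i) (length vs))"
    by (rule settled_value_le_wallet_bounds[OF assms])
  also have "\<dots> \<le> (\<Sum>i<k. C / real k)"
    by (intro sum_mono wallet_bound_le) (use assms in auto)
  \<comment> \<open>Only an inequality, since for \<open>k = 0\<close> the sum is empty.\<close>
  also have "\<dots> \<le> C" using assms(1) by simp
  finally show ?thesis .
qed

text \<open>Cuts a run at an epoch boundary; validity is all that is kept about the intermediate
  state. If \<open>n\<close> exceeds the length, the second part is empty.\<close>

lemma feasible_from_split:
  assumes "0 \<le> C" and "feasible_from C k F st vs ds" and "valid_state C k st"
    and "set vs \<subseteq> {0..}"
  obtains st' where "feasible_from C k F st (take n vs) (take n ds)"
    and "feasible_from C k F st' (drop n vs) (drop n ds)" and "valid_state C k st'"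
    and "settled_value vs ds =
      settled_value (take n vs) (take n ds) + settled_value (drop n vs) (drop n ds)"
proof -
  have "\<exists>st'. feasible_from C k F st (take n vs) (take n ds) \<and>
      feasible_from C k F st' (drop n vs) (drop n ds) \<and> valid_state C k st' \<and>
      settled_value vs ds =
        settled_value (take n vs) (take n ds) + settled_value (drop n vs) (drop n ds)"
    using assms
  proof (induction C k F st vs ds arbitrary: n rule: feasible_from.induct)
    case (1 C k F st)
    then show ?case by (auto simp: settled_value_def)
  next
    case (2 C k F st v vs d ds)
    show ?case
    proof (cases n)
      case 0
      then show ?thesis using 2 by (auto simp: settled_value_def)
    next
      case (Suc m)
      have "valid_state C k (next_state C k F st v d)"
        using 2 by (intro valid_state_next) auto
      then show ?thesis using 2 Suc by (fastforce simp: settled_value_Cons)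
    qed
  qed auto
  then show thesis using that by blast
qed


section \<open>FlushAll as a recursion over its state\<close>

text \<open>Carrying the state forward, instead of replaying the history in each slot, makes
  induction from an arbitrary state possible.\<close>

fun flush_all_value :: "real \<Rightarrow> nat \<Rightarrow> nat \<Rightarrow> state \<Rightarrow> real list \<Rightarrow> real" where
  "flush_all_value C k F st [] = 0"
| "flush_all_value C k F st (v # vs) =
     (if target (flush_all_rule k st v) = None then 0 else v) +
     flush_all_value C k F (next_state C k F st v (flush_all_rule k st v)) vs"

text \<open>Generalised over the history \<open>pre\<close>, because the induction moves one
  transaction at a time from \<open>post\<close> to \<open>pre\<close>.\<close>

lemma settled_value_flush_all:
  "settled_value post (map (\<lambda>N. flush_all C k F (pre @ take (Suc N) post)) [0..<length post])
     = flush_all_value C k F (flush_all_state C k F pre) post"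
proof (induction post arbitrary: pre)
  case Nil
  then show ?case by (simp add: settled_value_def)
next
  case (Cons v post)
  let ?d = "flush_all_rule k (flush_all_state C k F pre) v"
  have ds: "map (\<lambda>N. flush_all C k F (pre @ take (Suc N) (v # post))) [0..<length (v # post)] =
      ?d # map (\<lambda>N. flush_all C k F ((pre @ [v]) @ take (Suc N) post)) [0..<length post]"
    by (simp add: flush_all_def map_upt_Suc del: upt_Suc)
  show ?case
    unfolding ds settled_value_Cons Cons by (simp add: flush_all_state_def)
qed

lemma V_alg_flush_all:
  "V_alg (flush_all C k F) tx = flush_all_value C k F (initial_state C k) tx"
  using settled_value_flush_all[of tx C k F "[]"]
  by (simp add: V_alg_def decisions_def flush_all_state_def)

lemma flush_all_value_offline:
  assumes "1 \<le> k" and "1 \<le> m" and "\<forall>i<k. st i = Offline m"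
  obtains st' where "\<forall>i<k. st' i = Online (C / real k)"
    and "flush_all_value C k F st vs = flush_all_value C k F st' (drop m vs)"
proof -
  have "\<exists>st'. (\<forall>i<k. st' i = Online (C / real k)) \<and>
      flush_all_value C k F st vs = flush_all_value C k F st' (drop m vs)"
    using assms(2,3)
  proof (induction vs arbitrary: st m)
    case Nil
    show ?case by (rule exI[of _ "\<lambda>i. Online (C / real k)"]) simp
  next
    case (Cons v vs)
    \<comment> \<open>Wallet 0 exists and is offline, so the test that all wallets are online fails
      and no new flush starts.\<close>
    have "flush_all_rule k st v = Decision None {}"
      using Cons.prems assms(1) by (auto simp: flush_all_rule_def intro!: exI[of _ 0])
    then have step: "flush_all_value C k F st (v # vs) =
        flush_all_value C k F (next_state C k F st v (Decision None {})) vs"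
      by simp
    show ?case
    proof (cases "m = 1")
      case True
      then show ?thesis unfolding step using Cons.prems
        by (intro exI[of _ "next_state C k F st v (Decision None {})"])
           (auto simp: next_state_def)
    next
      case False
      then obtain p where "m = Suc p" "1 \<le> p" using Cons.prems(1) by (cases m) auto
      then show ?thesis unfolding step using Cons.prems
        by (auto simp: next_state_def intro!: Cons.IH)
    qed
  qed
  then show thesis using that by blast
qed


section \<open>Comparison of FlushAll with an arbitrary policy\<close>

text \<open>
  The last summand of the bound, \<open>1 / (1 - r)\<close> times the collateral that FlushAll has committed since
  its last flush, is the potential that makes the epoch argument an induction over slots.
\<close>

lemma settled_value_le_flush_all_value:
  fixes C T r :: real
  assumes "C > 0" and "k \<ge> 1" and "F \<ge> 1" and "T < C / real k" and r: "r = real k * T / C"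
    and "feasible_from C k F st vs ds" and "valid_state C k st" and "set vs \<subseteq> {0..T}"
    and "\<forall>i<k. sa i = Online (R i)" and "\<forall>i<k. R i \<le> C / real k"
  shows "settled_value vs ds \<le> (2 - r) / (1 - r) * flush_all_value C k F sa vs + C
    + (\<Sum>i<k. C / real k - R i) / (1 - r)"
  using assms(6-)
proof (induction "length vs" arbitrary: vs ds st sa R rule: less_induct)
  case less
  note feas = less.prems(1) and valid = less.prems(2) and range = less.prems(3)
    and sa = less.prems(4) and R = less.prems(5)
  have C: "0 \<le> C" using assms(1) by simp
  have r1: "r < 1"
    using assms(1,2,4) by (simp add: r field_simps)
  define \<alpha> where "\<alpha> = (2 - r) / (1 - r)"
  \<comment> \<open>When FlushAll settles \<open>v\<close>, the summand 1 pays for what the other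
    policy may settle in that slot, and \<open>1 / (1 - r)\<close> pays for the growth of the
    potential.\<close>
  have \<alpha>: "\<alpha> = 1 + 1 / (1 - r)"
    using r1 by (simp add: \<alpha>_def field_simps)
  define U where "U = (\<Sum>i<k. C / real k - R i)"
  show ?case
  proof (cases vs)
    case Nil
    have "0 \<le> U" unfolding U_def by (rule sum_nonneg) (use R in auto)
    then have "0 \<le> U / (1 - r)" using r1 by simp
    then show ?thesis using C Nil by (simp add: settled_value_def U_def)
  next
    case (Cons v vs')
    have v: "0 \<le> v" "v \<le> T" and vs: "set vs \<subseteq> {0..}" and vs': "set vs' \<subseteq> {0..T}"
      using range Cons by auto
    show ?thesis
    proof (cases "\<exists>i<k. fits (sa i) v")
      case True
      define j where "j = (LEAST i. i < k \<and> fits (sa i) v)"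
      have j: "j < k" "fits (sa j) v"
        using LeastI_ex[of "\<lambda>i. i < k \<and> fits (sa i) v"] True unfolding j_def by auto
      have rule: "flush_all_rule k sa v = Decision (Some j) {}"
        using True by (simp add: flush_all_rule_def j_def)
      let ?sa = "next_state C k F sa v (Decision (Some j) {})"
      let ?R = "R(j := R j - v)"
      have sa': "\<forall>i<k. ?sa i = Online (?R i)" and R': "\<forall>i<k. ?R i \<le> C / real k"
        using sa R v j by (auto simp: next_state_def intro: order_trans[of _ "R j"])
      have "(\<Sum>i<k. C / real k - ?R i) = (\<Sum>i<k. (C / real k - R i) + (if i = j then v else 0))"
        by (rule sum.cong) auto
      also have "\<dots> = U + v" using j by (simp add: sum.distrib U_def)
      finally have U': "(\<Sum>i<k. C / real k - ?R i) = U + v" .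
      obtain d ds' where ds: "ds = d # ds'" using feas Cons by (cases ds) auto
      have adm: "admissible k st v d"
        and feas': "feasible_from C k F (next_state C k F st v d) vs' ds'"
        using feas Cons ds by auto
      have "settled_value vs' ds' \<le> \<alpha> * flush_all_value C k F ?sa vs' + C + (U + v) / (1 - r)"
        unfolding U'[symmetric] \<alpha>_def
        by (rule less.hyps[OF _ feas' valid_state_next[OF C v(1) valid adm] vs' sa' R'])
           (simp add: Cons)
      moreover have "settled_value vs ds \<le> v + settled_value vs' ds'"
        using v by (simp add: Cons ds settled_value_Cons)
      moreover have "\<alpha> * flush_all_value C k F sa vs + U / (1 - r)
          = v + \<alpha> * flush_all_value C k F ?sa vs' + (U + v) / (1 - r)"
        by (simp add: Cons rule distrib_left add_divide_distrib) (simp add: \<alpha> distrib_right)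
      ultimately show ?thesis unfolding \<alpha>_def[symmetric] U_def[symmetric] by linarith
    next
      case False
      \<comment> \<open>FlushAll flushes now: each wallet has committed at least
        \<open>C / real k - T\<close>, so the potential is at least \<open>C\<close>.\<close>
      have "R i \<le> T" if "i < k" for i
        using False sa v that by force
      then have "(\<Sum>i<k. C / real k - T) \<le> U"
        unfolding U_def by (intro sum_mono) auto
      moreover have "(\<Sum>i<k. C / real k - T) = C * (1 - r)"
        using assms(1,2) by (simp add: r field_simps)
      ultimately have U: "C \<le> U / (1 - r)" using r1 by (simp add: field_simps)
      let ?sa = "next_state C k F sa v (Decision None {..<k})"
      have rule: "flush_all_rule k sa v = Decision None {..<k}"
        using False sa by (auto simp: flush_all_rule_def)
      have "\<forall>i<k. ?sa i = Offline F" by (simp add: next_state_def)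
      then obtain sb where sb: "\<forall>i<k. sb i = Online (C / real k)"
        and "flush_all_value C k F ?sa vs' = flush_all_value C k F sb (drop F vs')"
        using flush_all_value_offline[OF assms(2,3)] by metis
      then have FA: "flush_all_value C k F sa vs = flush_all_value C k F sb (drop (Suc F) vs)"
        by (simp add: Cons rule)
      \<comment> \<open>The slot of the flush together with the \<open>F\<close> offline slots:
        FlushAll settles nothing in them.\<close>
      let ?n = "Suc F"
      obtain st' where feas1: "feasible_from C k F st (take ?n vs) (take ?n ds)"
        and feas2: "feasible_from C k F st' (drop ?n vs) (drop ?n ds)"
        and valid': "valid_state C k st'"
        and split: "settled_value vs ds =
          settled_value (take ?n vs) (take ?n ds) + settled_value (drop ?n vs) (drop ?n ds)"
        by (rule feasible_from_split[OF C feas valid vs])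
      have "settled_value (take ?n vs) (take ?n ds) \<le> C"
        by (rule settled_value_window[OF C feas1 valid])
           (use vs set_take_subset[of ?n vs] in auto)
      \<comment> \<open>All wallets of FlushAll are full again, so the potential restarts at 0 and
        the old one is free to pay for the window.\<close>
      moreover have "settled_value (drop ?n vs) (drop ?n ds)
          \<le> \<alpha> * flush_all_value C k F sb (drop ?n vs) + C
            + (\<Sum>i<k. C / real k - C / real k) / (1 - r)"
        unfolding \<alpha>_def
        by (rule less.hyps[OF _ feas2 valid' _ sb])
           (use range set_drop_subset[of ?n vs] in \<open>auto simp: Cons\<close>)
      ultimately show ?thesis
        unfolding \<alpha>_def[symmetric] U_def[symmetric] FA split using U by simp
    qed
  qed
qed

theorem theorem1:
  fixes C T r :: real and k F :: nat
  assumes "C > 0" and "k \<ge> 1" and "F \<ge> 1"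
    and "0 < T" and "T < C / real k"
    and "r = real k * T / C"
  shows "competitive C k T F ((2 - r) / (1 - r)) (flush_all C k F)"
  unfolding competitive_def
proof (intro conjI exI allI impI)
  show "online_algorithm C k T F (flush_all C k F)"
    by (rule online_algorithm_flush_all)
next
  fix tx assume tx: "transaction_seq T tx"
  \<comment> \<open>The initial wallets are full, so the potential vanishes and only the constant
    \<open>C\<close> remains.\<close>
  have "settled_value tx ds \<le> (2 - r) / (1 - r) * V_alg (flush_all C k F) tx + C"
    if "feasible C k F tx ds" for ds
    using settled_value_le_flush_all_value[OF assms(1,2,3,5,6) that valid_state_initial,
        of "initial_state C k" "\<lambda>_. C / real k"] tx assms(1)
    by (simp add: V_alg_flush_all transaction_seq_def initial_state_def)
  then show "V_OPT C k F tx \<le> (2 - r) / (1 - r) * V_alg (flush_all C k F) tx + C"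
    unfolding V_OPT_def
    using finite_feasible_values feasible_values_nonempty by (subst Max_le_iff) auto
qed

end
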